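(* Algorithm A-BEAUTY is complete: run on any SLB instance $P=(G,v_s,V_g)$ for which a path from $v_s$ to a vertex of $V_g$ exists, it halts and returns such a path. Moreover, in that case the returned path $\pi$ satisfies $l_{\Phi^*(\pi)}=L^*$ (it is a shortest path tightest lower bound) and the returned bound equals $L^*$.
   Context: Estimated weighted digraph $G=(V,E,\Theta)$: $V$ vertices, $E\subseteq V\times V$ directed edges; each edge $e$ has an unknown true cost $c(e)\ge0$ and a finite non-empty sequence of estimators $\Theta(e)=(\theta_e^1,\dots,\theta_e^{k(e)})$, ordered by increasing running time; applying $\theta_e^i$ returns $(l_e^i,u_e^i)$ with $0\le l_e^i\le c(e)\le u_e^i<\infty$ and $[l_e^j,u_e^j]\subseteq[l_e^i,u_e^i]$ for $i<j$. For a path $p=\langle e_1,\dots,e_n\rangle$, $l_{\Phi^*(p)}:=\sum_i \max_j l_{e_i}^j$. An SLB instance is $P=(G,v_s,V_g)$ with $v_s\in V$, $V_g\subset V$, and $L^*:=\min\{l_{\Phi^*(p)}: p$ a path from $v_s$ to some vertex of $V_g\}$. Algorithm BEAUTY$(P;l_{est},l_{prune})$ returns a tuple (path, $Opt$, $\underline{l}^*$, $\bar l^*$). It maintains a priority queue OPEN keyed by values $g_l(\cdot)$, a set CLOSED, and parent pointers (updated whenever $g_l(s)$ is updated, so that $trace(n)$ reconstructs the path from $v_s$ to $n$). (1) Set $g_l(v_s)=0$, OPEN $=\{v_s\}$, CLOSED $=\emptyset$. (2) While OPEN $\neq\emptyset$: pop $n$ with minimal $g_l(n)$. If $n\in V_g$: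 let $\pi=trace(n)$, $l(\pi):=g_l(n)$, run the post-search procedure below and return $(\pi,Opt,\underline l^*,\bar l^* )$. Otherwise insert $n$ into CLOSED and, for each successor $s$ of $n$ with $e=(n,s)$: if $s\notin$ OPEN $\cup$ CLOSED set $g_l(s)=\infty$; set $\tilde g_l:=g_l(n)$; while $\tilde g_l<g_l(s)$ and estimators of $e$ remain, apply the next estimator of $e$ (in order $\theta_e^1,\theta_e^2,\dots$), record its lower bound as $l(e)$, set $\tilde g_l:=g_l(n)+l(e)$, and if $\tilde g_l>l_{est}$ exit this inner loop; then, if $\tilde g_l<g_l(s)$ and $\tilde g_l\le l_{prune}$, set $g_l(s):=\tilde g_l$ (with parent $n$), remove $s$ from OPEN if present, and insert $s$ into OPEN with key $g_l(s)$. (3) If OPEN empties, return $(\emptyset,false,\infty,\infty)$. Post-search procedure: set $Opt:=true$, $\underline l^*:=l(\pi)$; for each edge $e$ of $\pi$, if not all estimators of $e$ have been applied, apply its best estimator $\theta_e^{k(e)}$ obtaining $l$, set $l(\pi):=l(\pi)+l-l(e)$ and $l(e):=l$; afterwards if $l(\pi)>\underline l^*$ set $Opt:=false$; set $\bar l^*:=l(\pi)$ and return $(Opt,\underline l^*,\bar l^* )$. Algorithm A-BEAUTY$(P)$: set $\underline l^*:=0$, $\bar l^*:=\infty$, $Opt:=false$. While not $Opt$: call $(\pi,Opt,\underline l^*,\bar l):=$ BEAUTY$(P;\, l_{est}=\underline l^*,\, l_{prune}=\bar l^* )$; if $\pi=\emptyset$ return $(\emptyset,\infty)$; if $\bar l<\bar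 l^*$ set $\bar l^*:=\bar l$; output $(\pi,\underline l^*,\bar l^* )$. When the loop ends, return $(\pi,\bar l^* )$. Estimator results are cached across calls, so re-applying an estimator returns its saved value without recomputation. *)

theory Defs
  imports "Graph_Theory.Graph_Theory" "HOL-Library.Extended_Real"
begin

section \<open>Estimated weighted digraphs and SLB instances\<close>

text \<open>
  Applying an estimator always yields the same pair of bounds, so an estimator is represented by
  its running time and the pair it returns. In particular, whether a result is recomputed or read
  from a cache cannot be observed.
\<close>

record estimator =
  run_time :: real
  lower :: real
  upper :: real

record 'v slb =
  graph :: "'v pair_pre_digraph"
  cost :: "'v \<times> 'v \<Rightarrow> real"
  ests :: "'v \<times> 'v \<Rightarrow> estimator list"
  source :: 'v
  goals :: "'v set"

definition estimated_edge :: "'v slb \<Rightarrow> 'v \<times> 'v \<Rightarrow> bool" where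
  "estimated_edge P e \<longleftrightarrow>
     0 \<le> cost P e \<and>
     ests P e \<noteq> [] \<and>
     sorted (map run_time (ests P e)) \<and>
     (\<forall>t \<in> set (ests P e). 0 \<le> lower t \<and> lower t \<le> cost P e \<and> cost P e \<le> upper t) \<and>
     (\<forall>j < length (ests P e). \<forall>i < j.
        {lower (ests P e ! j) .. upper (ests P e ! j)}
          \<subseteq> {lower (ests P e ! i) .. upper (ests P e ! i)})"

text \<open>The locale predicate \<open>pair_fin_digraph\<close> says that vertices and edges are finite and that
  every edge joins two vertices.\<close>

definition slb_instance :: "'v slb \<Rightarrow> bool" where
  "slb_instance P \<longleftrightarrow>
     pair_fin_digraph (graph P) \<and>
     source P \<in> pverts (graph P) \<and>
     goals P \<subseteq> pverts (graph P) \<and>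
     (\<forall>e \<in> parcs (graph P). estimated_edge P e)"

text \<open>Paths are sequences of edges; the empty sequence is the path from a vertex to itself.\<close>

definition solution :: "'v slb \<Rightarrow> ('v \<times> 'v) list \<Rightarrow> bool" where
  "solution P p \<longleftrightarrow> (\<exists>v \<in> goals P. pre_digraph.awalk (with_proj (graph P)) (source P) p v)"

definition tight_lower :: "'v slb \<Rightarrow> ('v \<times> 'v) list \<Rightarrow> real" where
  "tight_lower P p = (\<Sum>e\<leftarrow>p. Max (lower ` set (ests P e)))"

text \<open>\<open>LEAST\<close> denotes the minimum of the set of path bounds, which need not be a finite set because
  walks may repeat vertices. The minimum exists whenever an instance has a solution.\<close>

definition L_star :: "'v slb \<Rightarrow> real" where
  "L_star P = (LEAST x. \<exists>p. solution P p \<and> x = tight_lower P p)"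


section \<open>BEAUTY\<close>

text \<open>
  \<open>applied e\<close> counts the estimators of \<open>e\<close> applied so far in the current call, and \<open>lb e\<close> is the
  lower bound recorded last, written \<open>l(e)\<close> in the pseudocode (it is read only for edges with at
  least one applied estimator). The priority queue is the set \<open>opn\<close> with keys \<open>gl\<close>: the key of a
  queued vertex and its \<open>gl\<close>-value are always changed together.
\<close>

record 'v search =
  opn :: "'v set"
  closed :: "'v set"
  gl :: "'v \<Rightarrow> ereal"
  parent :: "'v \<Rightarrow> 'v option"
  applied :: "'v \<times> 'v \<Rightarrow> nat"
  lb :: "'v \<times> 'v \<Rightarrow> real"

text \<open>Estimators are applied anew, starting with the first one, in every call of BEAUTY; only their
  results are shared between calls. Hence \<open>applied\<close> starts from \<open>0\<close>.\<close>

definition search_init :: "'v slb \<Rightarrow> 'v search" where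
  "search_init P =
     \<lparr>opn = {source P}, closed = {}, gl = (\<lambda>_. \<infinity>)(source P := 0), parent = Map.empty,
      applied = (\<lambda>_. 0), lb = (\<lambda>_. 0)\<rparr>"

text \<open>
  The inner estimation loop for an edge \<open>(n, s)\<close>: \<open>gn\<close> and \<open>gs\<close> are the values of \<open>n\<close> and \<open>s\<close>, the
  list holds the remaining estimators, and the loop variables \<open>(k, l, gt)\<close> are the number of
  applied estimators, the recorded lower bound, and the tentative value of \<open>s\<close>.
\<close>

fun estimate_loop ::
  "ereal \<Rightarrow> ereal \<Rightarrow> ereal \<Rightarrow> estimator list \<Rightarrow> nat \<times> real \<times> ereal \<Rightarrow> nat \<times> real \<times> ereal" where
  "estimate_loop l_est gn gs [] (k, l, gt) = (k, l, gt)"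
| "estimate_loop l_est gn gs (t # ts) (k, l, gt) =
     (if gt < gs then
        (let l' = lower t; gt' = gn + ereal l' in
         if gt' > l_est then (Suc k, l', gt')
         else estimate_loop l_est gn gs ts (Suc k, l', gt'))
      else (k, l, gt))"

definition relax ::
  "'v slb \<Rightarrow> ereal \<Rightarrow> ereal \<Rightarrow> 'v \<Rightarrow> 'v \<Rightarrow> 'v search \<Rightarrow> 'v search" where
  "relax P l_est l_prune n s \<sigma> =
     (let e = (n, s);
          g = (if s \<in> opn \<sigma> \<union> closed \<sigma> then gl \<sigma> else (gl \<sigma>)(s := \<infinity>));
          (k, l, gt) = estimate_loop l_est (g n) (g s) (drop (applied \<sigma> e) (ests P e))
                         (applied \<sigma> e, lb \<sigma> e, g n);
          \<sigma>' = \<sigma>\<lparr>gl := g, applied := (applied \<sigma>)(e := k), lb := (lb \<sigma>)(e := l)\<rparr>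
      in if gt < g s \<and> gt \<le> l_prune
         then \<sigma>'\<lparr>gl := g(s := gt), parent := (parent \<sigma>)(s \<mapsto> n), opn := insert s (opn \<sigma>)\<rparr>
         else \<sigma>')"

text \<open>\<open>trace par n p\<close>: following parent pointers back from \<open>n\<close> to a vertex without parent yields the
  path \<open>p\<close>.\<close>

inductive trace :: "('v \<Rightarrow> 'v option) \<Rightarrow> 'v \<Rightarrow> ('v \<times> 'v) list \<Rightarrow> bool"
  for par :: "'v \<Rightarrow> 'v option" where
  trace_root: "par n = None \<Longrightarrow> trace par n []"
| trace_step: "par s = Some n \<Longrightarrow> trace par n p \<Longrightarrow> trace par s (p @ [(n, s)])"

text \<open>The loop over the edges of the path found; the pair of loop variables holds \<open>l(\<pi>)\<close> and the
  recorded lower bounds \<open>l(e)\<close>.\<close>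

definition refine_edge ::
  "'v slb \<Rightarrow> 'v search \<Rightarrow> 'v \<times> 'v \<Rightarrow> ereal \<times> ('v \<times> 'v \<Rightarrow> real) \<Rightarrow> ereal \<times> ('v \<times> 'v \<Rightarrow> real)" where
  "refine_edge P \<sigma> e = (\<lambda>(x, le).
     if applied \<sigma> e < length (ests P e)
     then (let l = lower (last (ests P e)) in (x + ereal l - ereal (le e), le(e := l)))
     else (x, le))"

definition post_search ::
  "'v slb \<Rightarrow> 'v search \<Rightarrow> ('v \<times> 'v) list \<Rightarrow> ereal \<Rightarrow> bool \<times> ereal \<times> ereal" where
  "post_search P \<sigma> \<pi> l\<^sub>\<pi> =
     (let lo = l\<^sub>\<pi>; hi = fst (fold (refine_edge P \<sigma>) \<pi> (l\<^sub>\<pi>, lb \<sigma>))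
      in (\<not> hi > lo, lo, hi))"

text \<open>
  Control states of BEAUTY: the head of the main loop, the loop over the successors of the expanded
  vertex (with the set of successors still to be treated), and termination with the returned tuple,
  where \<open>None\<close> stands for the absence of a path. The order in which successors are treated and the
  choice among queued vertices of equal key are left open by the pseudocode, so the algorithm is
  given as a nondeterministic step relation.
\<close>

datatype 'v beauty_state =
    Search "'v search"
  | Expand 'v "'v set" "'v search"
  | Returned "('v \<times> 'v) list option" bool ereal ereal

definition min_open :: "'v search \<Rightarrow> 'v \<Rightarrow> bool" where
  "min_open \<sigma> n \<longleftrightarrow> n \<in> opn \<sigma> \<and> (\<forall>m \<in> opn \<sigma>. gl \<sigma> n \<le> gl \<sigma> m)"

inductive beauty_step ::
  "'v slb \<Rightarrow> ereal \<Rightarrow> ereal \<Rightarrow> 'v beauty_state \<Rightarrow> 'v beauty_state \<Rightarrow> bool"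
  for P :: "'v slb" and l_est l_prune :: ereal where
  search_goal:
    "min_open \<sigma> n \<Longrightarrow> n \<in> goals P \<Longrightarrow> trace (parent \<sigma>) n \<pi> \<Longrightarrow>
     post_search P \<sigma> \<pi> (gl \<sigma> n) = (opt, lo, hi) \<Longrightarrow>
     beauty_step P l_est l_prune (Search \<sigma>) (Returned (Some \<pi>) opt lo hi)"
| search_expand:
    "min_open \<sigma> n \<Longrightarrow> n \<notin> goals P \<Longrightarrow>
     beauty_step P l_est l_prune (Search \<sigma>)
       (Expand n {s. (n, s) \<in> parcs (graph P)}
          (\<sigma>\<lparr>opn := opn \<sigma> - {n}, closed := insert n (closed \<sigma>)\<rparr>))"
| search_fail:
    "opn \<sigma> = {} \<Longrightarrow> beauty_step P l_est l_prune (Search \<sigma>) (Returned None False \<infinity> \<infinity>)"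
| expand_succ:
    "s \<in> S \<Longrightarrow>
     beauty_step P l_est l_prune (Expand n S \<sigma>)
       (Expand n (S - {s}) (relax P l_est l_prune n s \<sigma>))"
| expand_done:
    "beauty_step P l_est l_prune (Expand n {} \<sigma>) (Search \<sigma>)"


section \<open>A-BEAUTY\<close>

text \<open>
  \<open>Loop \<pi> opt lo hi\<close> is the head of the outer loop with the current values of its variables (after
  each iteration, the tuple output is \<open>(\<pi>, lo, hi)\<close>); \<open>Call lo hi b\<close> is a running call of
  BEAUTY in state \<open>b\<close>; \<open>Halt \<pi> hi\<close> is termination with the returned pair.
\<close>

datatype 'v abeauty_state =
    Loop "('v \<times> 'v) list option" bool ereal ereal
  | Call ereal ereal "'v beauty_state"
  | Halt "('v \<times> 'v) list option" ereal

definition abeauty_init :: "'v abeauty_state" where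
  "abeauty_init = Loop None False 0 \<infinity>"

inductive abeauty_step :: "'v slb \<Rightarrow> 'v abeauty_state \<Rightarrow> 'v abeauty_state \<Rightarrow> bool"
  for P :: "'v slb" where
  call_beauty:
    "abeauty_step P (Loop \<pi> False lo hi) (Call lo hi (Search (search_init P)))"
| run_beauty:
    "beauty_step P lo hi b b' \<Longrightarrow> abeauty_step P (Call lo hi b) (Call lo hi b')"
| return_none:
    "abeauty_step P (Call lo hi (Returned None opt lo' hi')) (Halt None \<infinity>)"
| return_some:
    "abeauty_step P (Call lo hi (Returned (Some \<pi>) opt lo' hi'))
       (Loop (Some \<pi>) opt lo' (if hi' < hi then hi' else hi))"
| loop_done:
    "abeauty_step P (Loop \<pi> True lo hi) (Halt \<pi> hi)"

text \<open>Every run, however its nondeterminism is resolved, is finite.\<close>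

definition abeauty_halts :: "'v slb \<Rightarrow> bool" where
  "abeauty_halts P \<longleftrightarrow>
     \<not> (\<exists>r. r 0 = abeauty_init \<and> (\<forall>i::nat. abeauty_step P (r i) (r (Suc i))))"

text \<open>A run may end in any reachable state without successor. This includes states in which it would
  be stuck without having returned, for instance because no trace exists.\<close>

definition abeauty_final :: "'v slb \<Rightarrow> 'v abeauty_state \<Rightarrow> bool" where
  "abeauty_final P a \<longleftrightarrow>
     (abeauty_step P)\<^sup>*\<^sup>* abeauty_init a \<and> (\<nexists>a'. abeauty_step P a a')"

end

theory Submission
  imports Defs
begin

text \<open>
  BEAUTY is Dijkstra's search with lower bounds as weights. Every bound it records is at most the
  tightest one, so as long as \<open>l_prune\<close> is not below the tightest bound of some solution, the key
  \<open>l\<close> of the goal it pops is a lower bound on the tightest bound of every solution. If \<open>Opt\<close> is set,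
  the tightest bound of the path found is itself at most \<open>l\<close>, and the path is optimal. Otherwise
  some arc of the path has estimators left; its estimation ended because the tentative value
  exceeded \<open>l_est\<close>, hence \<open>l > l_est\<close>. So the lower bounds of successive calls increase strictly,
  and as sums of estimator bounds over sets of arcs they take only finitely many values.
\<close>

section \<open>Parent pointers and the estimation loop\<close>

text \<open>Identifies the path that \<open>search_goal\<close> picks with the one supplied by the
  search invariant.\<close>

lemma trace_unique:
  assumes "trace par n p" "trace par n q"
  shows "p = q"
  using assms
proof (induction arbitrary: q)
  case (trace_root n)
  then show ?case by (auto elim: trace.cases)
next
  case (trace_step s n p)
  from trace_step.prems trace_step.hyps(1) obtain q' where "q = q' @ [(n, s)]" "trace par n q'"
    by (auto elim: trace.cases)
  then show ?case using trace_step.IH by simp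
qed

text \<open>A trace reads \<open>par\<close> only at \<open>v\<close> and at the tails of the arcs
  of \<open>p\<close>.\<close>

lemma trace_parent_upd:
  assumes "trace par v p" "s \<noteq> v" "s \<notin> fst ` set p"
  shows "trace (par(s \<mapsto> n)) v p"
  using assms
proof induction
  case (trace_root n)
  then show ?case by (intro trace.trace_root) auto
next
  case (trace_step s' n p)
  then show ?case by (intro trace.trace_step) auto
qed

text \<open>The assumptions describe the loop after \<open>k\<close> rounds, so that the induction
  can start in the middle. If the final value still improves on \<open>gs\<close>, the guard did not
  stop the loop; what remains is an exhausted list or an exit above \<open>l_est\<close>.\<close>

lemma estimate_loop_result:
  assumes "estimate_loop l_est gn gs (drop k es) (k, l, gt) = (k', l', gt')"
    and "k \<le> length es"
    and "0 < k \<Longrightarrow> l = lower (es ! (k - 1)) \<and> gt = gn + ereal l"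
    and "k = 0 \<Longrightarrow> gt = gn"
  shows "k' \<le> length es"
    and "0 < k' \<Longrightarrow> l' = lower (es ! (k' - 1)) \<and> gt' = gn + ereal l'"
    and "k' = 0 \<Longrightarrow> gt' = gn"
    and "gt' < gs \<Longrightarrow> k' = length es \<or> 0 < k' \<and> l_est < gt'"
proof -
  have "k' \<le> length es \<and> (0 < k' \<longrightarrow> l' = lower (es ! (k' - 1)) \<and> gt' = gn + ereal l') \<and>
      (k' = 0 \<longrightarrow> gt' = gn) \<and> (gt' < gs \<longrightarrow> k' = length es \<or> 0 < k' \<and> l_est < gt')"
    using assms
  proof (induction "length es - k" arbitrary: k l gt)
    case 0
    then show ?case by auto
  next
    case (Suc d)
    then have k: "k < length es" by simp
    then have dr: "drop k es = es ! k # drop (Suc k) es" by (simp add: Cons_nth_drop_Suc)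
    let ?g = "gn + ereal (lower (es ! k))"
    show ?case
    proof (cases "gt < gs \<and> \<not> l_est < ?g")
      case True
      then have "estimate_loop l_est gn gs (drop (Suc k) es) (Suc k, lower (es ! k), ?g) = (k', l', gt')"
        using Suc.prems(1) by (simp add: dr Let_def)
      moreover have "d = length es - Suc k" using Suc by simp
      ultimately show ?thesis using Suc.hyps(1) k by simp
    next
      case False
      then show ?thesis using Suc.prems k by (auto simp: dr Let_def split: if_splits)
    qed
  qed
  then show "k' \<le> length es"
    and "0 < k' \<Longrightarrow> l' = lower (es ! (k' - 1)) \<and> gt' = gn + ereal l'"
    and "k' = 0 \<Longrightarrow> gt' = gn"
    and "gt' < gs \<Longrightarrow> k' = length es \<or> 0 < k' \<and> l_est < gt'" by auto
qed

lemma estimate_loop_idle: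
  "\<not> gt < gs \<Longrightarrow> estimate_loop l_est gn gs ts (k, l, gt) = (k, l, gt)"
  by (cases ts) auto

section \<open>Tightest bounds of arcs\<close>

locale slb_problem =
  fixes P :: "'v slb"
  assumes inst: "slb_instance P"
begin

sublocale pair_fin_digraph "graph P"
  using inst by (simp add: slb_instance_def)

definition tight :: "'v \<times> 'v \<Rightarrow> real" where
  "tight e = Max (lower ` set (ests P e))"

lemma tight_lower_sum: "tight_lower P p = (\<Sum>e\<leftarrow>p. tight e)"
  by (simp add: tight_lower_def tight_def)

text \<open>Nested nonempty intervals have nondecreasing lower endpoints, so the maximum belongs to
  the last estimator, the one that the post-search procedure applies.\<close>

lemma
  assumes "e \<in> parcs (graph P)"
  shows ests_nonempty: "ests P e \<noteq> []"
    and lower_nonneg: "i < length (ests P e) \<Longrightarrow> 0 \<le> lower (ests P e ! i)"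
    and lower_le_tight: "i < length (ests P e) \<Longrightarrow> lower (ests P e ! i) \<le> tight e"
    and tight_last: "tight e = lower (last (ests P e))"
    and tight_nonneg: "0 \<le> tight e"
proof -
  let ?es = "ests P e"
  have ee: "estimated_edge P e" using inst assms by (simp add: slb_instance_def)
  then show ne: "?es \<noteq> []" by (simp add: estimated_edge_def)
  from ee have b: "lower (?es ! i) \<le> upper (?es ! i)" "0 \<le> lower (?es ! i)" if "i < length ?es" for i
    using that nth_mem[OF that] unfolding estimated_edge_def by (meson order_trans)+
  then show "i < length ?es \<Longrightarrow> 0 \<le> lower (?es ! i)" by blast
  show le: "i < length ?es \<Longrightarrow> lower (?es ! i) \<le> tight e" for i
    by (simp add: tight_def)
  \<comment> \<open>Inclusion compares left endpoints because \<open>b\<close> makes the inner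
    interval nonempty.\<close>
  have "lower (?es ! i) \<le> lower (?es ! j)" if "j < length ?es" "i < j" for i j
    using ee that b[OF that(1)] by (auto simp: estimated_edge_def)
  then have "lower t \<le> lower (last ?es)" if "t \<in> set ?es" for t
    using that ne by (auto simp: in_set_conv_nth last_conv_nth)
      (metis One_nat_def Suc_pred diff_less length_greater_0_conv less_Suc_eq less_numeral_extra(1) order_refl)
  then show "tight e = lower (last ?es)"
    unfolding tight_def using ne by (intro Max_eqI) auto
  show "0 \<le> tight e" using b(2)[of 0] le[of 0] ne by fastforce
qed

lemma solution_iff: "solution P p \<longleftrightarrow> (\<exists>v \<in> goals P. awalk (source P) p v)"
  by (simp add: solution_def)

lemma sum_tight_nonneg: "set p \<subseteq> parcs (graph P) \<Longrightarrow> 0 \<le> (\<Sum>e\<leftarrow>p. tight e)"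
  by (intro sum_list_nonneg) (auto intro: tight_nonneg)

section \<open>The search invariant\<close>

text \<open>At count \<open>0\<close> the value of \<open>lb\<close> is a mere default, so the count
  must be positive; the list is indexed from \<open>0\<close>, hence the shift by one.\<close>

definition estimated :: "'v search \<Rightarrow> 'v \<times> 'v \<Rightarrow> bool" where
  "estimated \<sigma> e \<longleftrightarrow> 0 < applied \<sigma> e \<and> applied \<sigma> e \<le> length (ests P e) \<and>
     lb \<sigma> e = lower (ests P e ! (applied \<sigma> e - 1))"

text \<open>Paths run through closed vertices because these keep their keys and parents.
  Distinctness makes the key a sum over a set of arcs. The clause for keys at most
  \<open>l_est\<close> later shows that a call without \<open>opt\<close> raises the lower
  bound.\<close>

definition traced :: "ereal \<Rightarrow> ereal \<Rightarrow> 'v search \<Rightarrow> 'v \<Rightarrow> ('v \<times> 'v) list \<Rightarrow> bool" where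
  "traced l_est l_prune \<sigma> v p \<longleftrightarrow>
     trace (parent \<sigma>) v p \<and> awalk (source P) p v \<and> distinct p \<and>
     fst ` set p \<subseteq> closed \<sigma> \<and> snd ` set p \<subseteq> insert v (closed \<sigma>) \<and>
     (\<forall>e \<in> set p. estimated \<sigma> e) \<and>
     gl \<sigma> v = ereal (\<Sum>e\<leftarrow>p. lb \<sigma> e) \<and>
     (gl \<sigma> v \<le> l_est \<longrightarrow> (\<forall>e \<in> set p. applied \<sigma> e = length (ests P e))) \<and>
     gl \<sigma> v \<le> l_prune"

text \<open>\<open>R\<close> is the set of arcs relaxed so far, and \<open>\<kappa>\<close> separates the keys of closed from those of
  open vertices. The separation is why closed vertices are never reopened, so that every arc is
  relaxed at most once.\<close>

definition search_inv :: "ereal \<Rightarrow> ereal \<Rightarrow> ('v \<times> 'v) set \<Rightarrow> ereal \<Rightarrow> 'v search \<Rightarrow> bool" where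
  "search_inv l_est l_prune R \<kappa> \<sigma> \<longleftrightarrow>
     opn \<sigma> \<inter> closed \<sigma> = {} \<and> opn \<sigma> \<union> closed \<sigma> \<subseteq> pverts (graph P) \<and>
     source P \<in> opn \<sigma> \<union> closed \<sigma> \<and> gl \<sigma> (source P) \<le> 0 \<and>
     closed \<sigma> \<inter> goals P = {} \<and>
     (\<forall>v \<in> closed \<sigma>. gl \<sigma> v \<le> \<kappa>) \<and> (\<forall>v \<in> opn \<sigma>. \<kappa> \<le> gl \<sigma> v) \<and>
     (\<forall>v \<in> opn \<sigma> \<union> closed \<sigma>. \<exists>p. traced l_est l_prune \<sigma> v p) \<and>
     fst ` R \<subseteq> closed \<sigma> \<and>
     (\<forall>(a, b) \<in> R. l_prune < gl \<sigma> a + ereal (tight (a, b)) \<or>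
        b \<in> opn \<sigma> \<union> closed \<sigma> \<and> gl \<sigma> b \<le> gl \<sigma> a + ereal (tight (a, b))) \<and>
     (\<forall>e. e \<notin> R \<longrightarrow> applied \<sigma> e = 0)"

lemma search_inv_traced:
  "search_inv l_est l_prune R \<kappa> \<sigma> \<Longrightarrow> v \<in> opn \<sigma> \<union> closed \<sigma> \<Longrightarrow> \<exists>p. traced l_est l_prune \<sigma> v p"
  by (simp add: search_inv_def)

lemma search_inv_relaxed:
  assumes "search_inv l_est l_prune R \<kappa> \<sigma>" "(a, b) \<in> R"
  shows "l_prune < gl \<sigma> a + ereal (tight (a, b)) \<or>
    b \<in> opn \<sigma> \<union> closed \<sigma> \<and> gl \<sigma> b \<le> gl \<sigma> a + ereal (tight (a, b))"
  using assms unfolding search_inv_def by fast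

text \<open>The source is queued with key \<open>0\<close>, which must itself respect the pruning
  bound.\<close>

lemma search_inv_init:
  assumes "0 \<le> l_prune"
  shows "search_inv l_est l_prune {} 0 (search_init P)"
proof -
  have src: "source P \<in> pverts (graph P)" using inst by (simp add: slb_instance_def)
  then have "traced l_est l_prune (search_init P) (source P) []"
    using assms by (auto simp: traced_def search_init_def awalk_Nil_iff intro: trace_root)
  then show ?thesis using src by (auto simp: search_inv_def search_init_def)
qed

text \<open>The tentative value starts at the key of \<open>n\<close>, which does not improve on
  that of \<open>s\<close>: the loop does nothing and every update writes back the old
  value.\<close>

lemma relax_closed:
  assumes "s \<in> closed \<sigma>" "gl \<sigma> s \<le> gl \<sigma> n"
  shows "relax P l_est l_prune n s \<sigma> = \<sigma>"
  using assms by (simp add: relax_def estimate_loop_idle Let_def leD)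

text \<open>Unless \<open>s\<close> is closed, only data of \<open>s\<close> and of the arc
  \<open>(n, s)\<close> change. Traced paths of other vertices are unaffected: \<open>s\<close> is
  not closed, hence not a tail on them, and the arc had no estimator applied, hence is not on
  them.\<close>

lemma search_inv_relax:
  assumes inv: "search_inv l_est l_prune R (gl \<sigma> n) \<sigma>"
    and n: "n \<in> closed \<sigma>" and e: "(n, s) \<in> parcs (graph P)" "(n, s) \<notin> R"
  shows "search_inv l_est l_prune (insert (n, s) R) (gl \<sigma> n) (relax P l_est l_prune n s \<sigma>) \<and>
    closed (relax P l_est l_prune n s \<sigma>) = closed \<sigma> \<and>
    gl (relax P l_est l_prune n s \<sigma>) n = gl \<sigma> n"
proof (cases "s \<in> closed \<sigma>")
  case True
  then have le: "gl \<sigma> s \<le> gl \<sigma> n" using inv by (simp add: search_inv_def)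
  moreover have "gl \<sigma> n \<le> gl \<sigma> n + ereal (tight (n, s))"
    using tight_nonneg[OF e(1)] by (cases "gl \<sigma> n") auto
  ultimately have "gl \<sigma> s \<le> gl \<sigma> n + ereal (tight (n, s))" by (rule order_trans)
  then show ?thesis
    using True inv n by (simp add: relax_closed[OF True le] search_inv_def)
next
  case False
  let ?e = "(n, s)"
  \<comment> \<open>Closed vertices being excluded here, a vertex outside the queue is new and
    starts from \<infinity>.\<close>
  define g where "g = (if s \<in> opn \<sigma> then gl \<sigma> else (gl \<sigma>)(s := \<infinity>))"
  have sn: "s \<noteq> n" using n False by auto
  then have gn: "g n = gl \<sigma> n" by (simp add: g_def)
  have app0: "applied \<sigma> ?e = 0" using inv e by (simp add: search_inv_def)
  obtain k l gt where loop:
    "estimate_loop l_est (gl \<sigma> n) (g s) (drop 0 (ests P ?e)) (0, lb \<sigma> ?e, gl \<sigma> n) = (k, l, gt)"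
    by (metis prod_cases3)
  note res = estimate_loop_result[OF loop]
  have k: "k \<le> length (ests P ?e)" using res(1) by simp
  have kpos: "l = lower (ests P ?e ! (k - 1))" "gt = gl \<sigma> n + ereal l" if "0 < k" using res(2) that by auto
  have kz: "gt = gl \<sigma> n" if "k = 0" using res(3) that by simp
  \<comment> \<open>An improving value has used at least one estimator: even a full count is
    positive, as no estimator list of an arc is empty.\<close>
  have kfull: "k = length (ests P ?e) \<or> l_est < gt" and kgt: "0 < k" if "gt < g s"
    using res(4) that ests_nonempty[OF e(1)] by auto
  have lb: "0 \<le> l" "l \<le> tight ?e" if "0 < k"
    using kpos(1) that k lower_nonneg[OF e(1), of "k - 1"] lower_le_tight[OF e(1), of "k - 1"] by auto
  obtain pn where pn: "traced l_est l_prune \<sigma> n pn"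
    using search_inv_traced[OF inv] n by blast
  then obtain x where x: "gl \<sigma> n = ereal x" by (auto simp: traced_def)
  \<comment> \<open>The upper estimate serves the relaxation condition, the lower one keeps open
    keys at or above \<kappa>.\<close>
  have gt_le: "gt \<le> gl \<sigma> n + ereal (tight ?e)" and gt_ge: "gl \<sigma> n \<le> gt"
    using kz kpos(2) lb tight_nonneg[OF e(1)] by (cases "k = 0"; simp add: x)+
  define \<sigma>1 where "\<sigma>1 = \<sigma>\<lparr>gl := g, applied := (applied \<sigma>)(?e := k), lb := (lb \<sigma>)(?e := l)\<rparr>"
  define \<tau> where "\<tau> = relax P l_est l_prune n s \<sigma>"
  have \<tau>: "\<tau> = (if gt < g s \<and> gt \<le> l_prune
      then \<sigma>1\<lparr>gl := g(s := gt), parent := (parent \<sigma>)(s \<mapsto> n), opn := insert s (opn \<sigma>)\<rparr> else \<sigma>1)"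
    using False loop gn by (simp add: \<tau>_def relax_def Let_def app0 g_def \<sigma>1_def)
  have cl: "closed \<tau> = closed \<sigma>" by (simp add: \<tau> \<sigma>1_def)
  have gl_other: "gl \<tau> v = gl \<sigma> v" if "v \<noteq> s" for v
    using that by (auto simp: \<tau> \<sigma>1_def g_def)
  have gl_s: "gl \<tau> s \<le> gl \<sigma> s" if "s \<in> opn \<sigma>"
    using that by (auto simp: \<tau> \<sigma>1_def g_def)
  have ap: "applied \<tau> = (applied \<sigma>)(?e := k)" and lbt: "lb \<tau> = (lb \<sigma>)(?e := l)"
    by (auto simp: \<tau> \<sigma>1_def)
  have par: "parent \<tau> = (if gt < g s \<and> gt \<le> l_prune then (parent \<sigma>)(s \<mapsto> n) else parent \<sigma>)"
    by (simp add: \<tau> \<sigma>1_def)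
  have opn: "opn \<tau> = (if gt < g s \<and> gt \<le> l_prune then insert s (opn \<sigma>) else opn \<sigma>)"
    by (simp add: \<tau> \<sigma>1_def)
  have keep: "traced l_est l_prune \<tau> v p"
    if p: "traced l_est l_prune \<sigma> v p" and v: "v \<noteq> s \<or> s \<in> opn \<sigma> \<and> \<not> (gt < g s \<and> gt \<le> l_prune)" for v p
  proof -
    have "?e \<notin> set p" using p app0 by (auto simp: traced_def estimated_def)
    then have same: "applied \<tau> e' = applied \<sigma> e'" "lb \<tau> e' = lb \<sigma> e'" if "e' \<in> set p" for e'
      using that by (auto simp: ap lbt)
    have sum: "(\<Sum>e\<leftarrow>p. lb \<tau> e) = (\<Sum>e\<leftarrow>p. lb \<sigma> e)"
      by (intro arg_cong[where f = sum_list] map_cong) (auto simp: same)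
    have glv: "gl \<tau> v = gl \<sigma> v" using v by (auto simp: \<tau> \<sigma>1_def g_def)
    have "s \<notin> fst ` set p" using p False by (auto simp: traced_def)
    then have "trace (parent \<tau>) v p"
      using p v by (auto simp: par traced_def intro!: trace_parent_upd)
    then show ?thesis
      using p by (auto simp: traced_def sum glv cl estimated_def same)
  qed
  have traced: "\<exists>p. traced l_est l_prune \<tau> v p" if v: "v \<in> opn \<tau> \<union> closed \<tau>" for v
  proof (cases "v = s \<and> gt < g s \<and> gt \<le> l_prune")
    case True
    have t: "traced l_est l_prune \<tau> n pn" using keep[OF pn] sn by simp
    have nin: "?e \<notin> set pn" using pn app0 by (auto simp: traced_def estimated_def)
    have kp: "0 < k" using kgt True by simp
    have gls: "gl \<tau> s = gt" using True by (simp add: \<tau>)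
    have gln: "gl \<tau> n = gl \<sigma> n" using gl_other sn by simp
    have "traced l_est l_prune \<tau> s (pn @ [?e])"
      unfolding traced_def
    proof (intro conjI)
      show "trace (parent \<tau>) s (pn @ [?e])"
        using t True by (intro trace_step) (auto simp: par traced_def)
      show "awalk (source P) (pn @ [?e]) s"
        using t arc_implies_awalk[of ?e] e(1) by (auto simp: traced_def)
      show "gl \<tau> s = ereal (\<Sum>e\<leftarrow>pn @ [?e]. lb \<tau> e)"
        using t by (simp add: traced_def gls kpos(2)[OF kp] lbt gln flip: plus_ereal.simps)
      show "\<forall>e \<in> set (pn @ [?e]). estimated \<tau> e"
        using t kp k kpos(1)[OF kp] by (auto simp: traced_def estimated_def ap lbt)
      show "gl \<tau> s \<le> l_est \<longrightarrow> (\<forall>e \<in> set (pn @ [?e]). applied \<tau> e = length (ests P e))"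
      proof
        \<comment> \<open>The key of \<open>n\<close> is no larger, so the prefix is exhausted; for
          the last arc an exit above \<open>l_est\<close> is ruled out.\<close>
        assume "gl \<tau> s \<le> l_est"
        then have a: "gt \<le> l_est" by (simp add: gls)
        then have "gl \<tau> n \<le> l_est" using gt_ge gln by simp
        moreover have "k = length (ests P ?e)" using kfull True a by auto
        ultimately show "\<forall>e \<in> set (pn @ [?e]). applied \<tau> e = length (ests P e)"
          using t by (auto simp: traced_def ap)
      qed
    qed (use t nin n cl True gls in \<open>auto simp: traced_def\<close>)
    then show ?thesis using True by blast
  next
    case F: False
    have "v \<in> opn \<sigma> \<union> closed \<sigma>" using v F by (auto simp: opn cl split: if_splits)
    then obtain p where "traced l_est l_prune \<sigma> v p" using search_inv_traced[OF inv] by blast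
    moreover have "v \<noteq> s \<or> s \<in> opn \<sigma> \<and> \<not> (gt < g s \<and> gt \<le> l_prune)"
      using F v False by (auto simp: opn cl)
    ultimately show ?thesis using keep by blast
  qed
  \<comment> \<open>An improving value is either pruned, hence above \<open>l_prune\<close>, or
    becomes the key. A value that does not improve is finite, so \<open>s\<close> was queued with a
    key at most as large.\<close>
  have new: "l_prune < gl \<tau> n + ereal (tight ?e) \<or>
      s \<in> opn \<tau> \<union> closed \<tau> \<and> gl \<tau> s \<le> gl \<tau> n + ereal (tight ?e)"
  proof (cases "gt < g s")
    case True
    then show ?thesis
      using gt_le gl_other[of n] sn by (cases "gt \<le> l_prune") (auto simp: opn \<tau>)
  next
    case F: False
    have "gt \<noteq> \<infinity>" using gt_le by (auto simp: x)
    then have "s \<in> opn \<sigma>" using F by (auto simp: g_def split: if_splits)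
    moreover have "gl \<tau> s \<le> gt" using F by (simp add: \<tau> \<sigma>1_def)
    ultimately show ?thesis using gt_le gl_other[of n] sn by (auto simp: opn intro: order_trans)
  qed
  \<comment> \<open>Tails of relaxed arcs are closed and keep their keys, while keys of known heads
    can only fall.\<close>
  have old: "l_prune < gl \<tau> a + ereal (tight (a, b)) \<or>
      b \<in> opn \<tau> \<union> closed \<tau> \<and> gl \<tau> b \<le> gl \<tau> a + ereal (tight (a, b))" if ab: "(a, b) \<in> R" for a b
  proof -
    have "fst ` R \<subseteq> closed \<sigma>" using inv by (simp add: search_inv_def)
    then have "a \<in> closed \<sigma>" using ab by force
    then have a: "gl \<tau> a = gl \<sigma> a" using False by (intro gl_other) auto
    have "l_prune < gl \<sigma> a + ereal (tight (a, b)) \<or>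
      b \<in> opn \<sigma> \<union> closed \<sigma> \<and> gl \<sigma> b \<le> gl \<sigma> a + ereal (tight (a, b))"
      by (rule search_inv_relaxed[OF inv ab])
    moreover have "gl \<tau> b \<le> gl \<sigma> b" if "b \<in> opn \<sigma> \<union> closed \<sigma>"
      using that gl_s gl_other[of b] False by (cases "b = s") auto
    ultimately show ?thesis by (auto simp: a opn cl intro: order_trans)
  qed
  have sv: "s \<in> pverts (graph P)" using e(1) in_arcsD2 by blast
  have "search_inv l_est l_prune (insert ?e R) (gl \<sigma> n) \<tau>"
    unfolding search_inv_def
  proof (intro conjI)
    show "\<forall>v \<in> opn \<tau> \<union> closed \<tau>. \<exists>p. traced l_est l_prune \<tau> v p" using traced by blast
    show "\<forall>(a, b) \<in> insert ?e R. l_prune < gl \<tau> a + ereal (tight (a, b)) \<or>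
        b \<in> opn \<tau> \<union> closed \<tau> \<and> gl \<tau> b \<le> gl \<tau> a + ereal (tight (a, b))"
      using new old by blast
    show "\<forall>v \<in> opn \<tau>. gl \<sigma> n \<le> gl \<tau> v"
      using inv gt_ge by (auto simp: search_inv_def \<tau> \<sigma>1_def g_def)
    show "\<forall>v \<in> closed \<tau>. gl \<tau> v \<le> gl \<sigma> n"
      using inv False gl_other unfolding cl search_inv_def by metis
    show "opn \<tau> \<inter> closed \<tau> = {}"
      using inv False by (auto simp: search_inv_def opn cl)
    show "opn \<tau> \<union> closed \<tau> \<subseteq> pverts (graph P)"
      using inv sv by (auto simp: search_inv_def opn cl)
    show "source P \<in> opn \<tau> \<union> closed \<tau>"
      using inv by (auto simp: search_inv_def opn cl)
    show "gl \<tau> (source P) \<le> 0"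
    proof (cases "source P = s")
      case True
      then have "s \<in> opn \<sigma>" "gl \<sigma> s \<le> 0" using inv False by (auto simp: search_inv_def)
      then show ?thesis using gl_s True by auto
    qed (use inv gl_other in \<open>auto simp: search_inv_def\<close>)
    show "closed \<tau> \<inter> goals P = {}"
      using inv by (auto simp: search_inv_def cl)
    show "fst ` insert ?e R \<subseteq> closed \<tau>"
      using inv n by (auto simp: search_inv_def cl)
    show "\<forall>e. e \<notin> insert ?e R \<longrightarrow> applied \<tau> e = 0"
      using inv by (auto simp: search_inv_def ap)
  qed
  then show ?thesis using cl gl_other sn by (simp add: \<tau>_def)
qed

section \<open>The frontier of the search\<close>

text \<open>Gives the set \<open>R\<close> at the head of the main loop, when every closed vertex
  has been fully expanded.\<close>

definition out_arcs_of :: "'v set \<Rightarrow> ('v \<times> 'v) set" where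
  "out_arcs_of C = {e \<in> parcs (graph P). fst e \<in> C}"

text \<open>Dijkstra's frontier argument. While the walk stays in closed vertices, keys are at most
  the tight weight of the prefix; where it leaves them it meets an open vertex with such a key.
  Pruning cannot interfere, since no prefix weighs more than the walk.\<close>

lemma open_on_walk:
  assumes inv: "search_inv l_est l_prune (out_arcs_of (closed \<sigma>)) \<kappa> \<sigma>"
    and "awalk (source P) p v" "ereal (\<Sum>e\<leftarrow>p. tight e) \<le> l_prune"
  shows "(\<exists>m \<in> opn \<sigma>. gl \<sigma> m \<le> ereal (\<Sum>e\<leftarrow>p. tight e)) \<or>
    v \<in> closed \<sigma> \<and> gl \<sigma> v \<le> ereal (\<Sum>e\<leftarrow>p. tight e)"
  using assms(2-)
proof (induction p arbitrary: v rule: rev_induct)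
  case Nil
  then show ?case using inv by (auto simp: awalk_Nil_iff search_inv_def zero_ereal_def)
next
  case (snoc e p)
  obtain a b where ab: "e = (a, b)" by force
  have w: "awalk (source P) p a" and e: "(a, b) \<in> parcs (graph P)" and b: "b = v"
    using snoc.prems(1) by (auto simp: ab awalk_Cons_iff awalk_Nil_iff)
  have pos: "0 \<le> tight e" using tight_nonneg e ab by simp
  then have le: "ereal (\<Sum>e\<leftarrow>p. tight e) \<le> ereal (\<Sum>e\<leftarrow>p @ [e]. tight e)" by simp
  from snoc.IH[OF w order_trans[OF le snoc.prems(2)]] show ?case
  proof
    assume "\<exists>m \<in> opn \<sigma>. gl \<sigma> m \<le> ereal (\<Sum>e\<leftarrow>p. tight e)"
    then show ?thesis using le by (meson order_trans)
  next
    assume a: "a \<in> closed \<sigma> \<and> gl \<sigma> a \<le> ereal (\<Sum>e\<leftarrow>p. tight e)"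
    then have "(a, b) \<in> out_arcs_of (closed \<sigma>)" using e by (simp add: out_arcs_of_def)
    then have "l_prune < gl \<sigma> a + ereal (tight (a, b)) \<or>
        b \<in> opn \<sigma> \<union> closed \<sigma> \<and> gl \<sigma> b \<le> gl \<sigma> a + ereal (tight (a, b))"
      by (rule search_inv_relaxed[OF inv])
    moreover have "gl \<sigma> a + ereal (tight (a, b)) \<le> ereal (\<Sum>e\<leftarrow>p @ [e]. tight e)"
      using a add_right_mono[of "gl \<sigma> a" "ereal (\<Sum>e\<leftarrow>p. tight e)" "ereal (tight (a, b))"]
      by (simp add: ab)
    ultimately have "b \<in> opn \<sigma> \<union> closed \<sigma> \<and> gl \<sigma> b \<le> ereal (\<Sum>e\<leftarrow>p @ [e]. tight e)"
      using snoc.prems(2) by (meson leD less_le_trans order_trans)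
    then show ?thesis using b by blast
  qed
qed

text \<open>A goal is never closed, so for a walk to a goal only the open vertex remains.\<close>

lemma open_below_solution:
  assumes "search_inv l_est l_prune (out_arcs_of (closed \<sigma>)) \<kappa> \<sigma>"
    and "solution P p" "ereal (tight_lower P p) \<le> l_prune"
  shows "\<exists>m \<in> opn \<sigma>. gl \<sigma> m \<le> ereal (tight_lower P p)"
proof -
  obtain v where v: "v \<in> goals P" "awalk (source P) p v" using assms(2) by (auto simp: solution_iff)
  moreover have "v \<notin> closed \<sigma>" using assms(1) v(1) by (auto simp: search_inv_def)
  ultimately show ?thesis using open_on_walk[OF assms(1) v(2)] assms(3) by (simp add: tight_lower_sum)
qed

section \<open>The post-search refinement\<close>

text \<open>Each round adds the gap between tightest and recorded bound, which is zero for exhausted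
  arcs. By distinctness an updated bound is not read again.\<close>

lemma fold_refine_edge:
  assumes "distinct p" "set p \<subseteq> parcs (graph P)"
    and "\<And>e. e \<in> set p \<Longrightarrow> applied \<sigma> e < length (ests P e) \<or> le e = tight e"
  shows "fst (fold (refine_edge P \<sigma>) p (ereal x, le)) = ereal (x + (\<Sum>e\<leftarrow>p. tight e - le e))"
  using assms
proof (induction p arbitrary: x le)
  case (Cons e p)
  show ?case
  proof (cases "applied \<sigma> e < length (ests P e)")
    case True
    have e: "lower (last (ests P e)) = tight e" using Cons.prems by (simp add: tight_last)
    have "(\<Sum>e'\<leftarrow>p. tight e' - (le(e := tight e)) e') = (\<Sum>e'\<leftarrow>p. tight e' - le e')"
      using Cons.prems(1) by (intro arg_cong[where f = sum_list] map_cong) auto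
    moreover have "fst (fold (refine_edge P \<sigma>) p (ereal (x + tight e - le e), le(e := tight e)))
        = ereal (x + tight e - le e + (\<Sum>e'\<leftarrow>p. tight e' - (le(e := tight e)) e'))"
      using Cons.prems by (intro Cons.IH) auto
    moreover have "refine_edge P \<sigma> e (ereal x, le) = (ereal (x + tight e - le e), le(e := tight e))"
      using True by (simp add: refine_edge_def Let_def e)
    ultimately show ?thesis by (simp add: algebra_simps)
  next
    case False
    then have "le e = tight e" using Cons.prems(3)[of e] by simp
    moreover have "refine_edge P \<sigma> e (ereal x, le) = (ereal x, le)"
      using False by (simp add: refine_edge_def)
    ultimately show ?thesis using Cons by simp
  qed
qed simp

section \<open>Finitely many lower bounds\<close>

text \<open>Choosing one estimator per arc and summing over a set of arcs covers the keys of all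
  traced paths, as these repeat no arc.\<close>

definition bound_values :: "real set" where
  "bound_values = (\<lambda>(A, f). sum f A) `
     (Pow (parcs (graph P)) \<times> (\<Pi>\<^sub>E e \<in> parcs (graph P). lower ` set (ests P e)))"

lemma finite_bound_values: "finite bound_values"
  unfolding bound_values_def
  by (intro finite_imageI finite_cartesian_product finite_PiE) auto

lemma bound_valuesI:
  assumes "distinct p" "set p \<subseteq> parcs (graph P)" "\<And>e. e \<in> set p \<Longrightarrow> f e \<in> lower ` set (ests P e)"
  shows "(\<Sum>e\<leftarrow>p. f e) \<in> bound_values"
proof -
  \<comment> \<open>Off the path any estimator will do; \<open>undefined\<close> outside the arcs
    places \<open>f'\<close> in the extensional product.\<close>
  define f' where "f' = (\<lambda>e. if e \<in> parcs (graph P)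
    then (if e \<in> set p then f e else lower (hd (ests P e))) else undefined)"
  have "f' \<in> (\<Pi>\<^sub>E e \<in> parcs (graph P). lower ` set (ests P e))"
    using assms(3) ests_nonempty by (auto simp: f'_def PiE_def extensional_def)
  moreover have "(\<Sum>e\<leftarrow>p. f e) = sum f' (set p)"
    using assms(1,2) by (auto simp: sum_list_distinct_conv_sum_set f'_def intro!: sum.cong)
  ultimately show ?thesis
    unfolding bound_values_def using assms(2) by (intro image_eqI[where x = "(set p, f')"]) auto
qed

section \<open>Invariant and progress of BEAUTY\<close>

text \<open>During an expansion the arcs from \<open>n\<close> into \<open>S\<close> are pending and
  \<kappa> is the key of \<open>n\<close>. For a returned path, \<open>lo \<le> l_prune\<close> will
  make \<open>hi\<close> the new upper bound when \<open>opt\<close> holds, and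
  \<open>l_est < lo\<close> will drive the outer loop.\<close>

fun beauty_inv :: "ereal \<Rightarrow> ereal \<Rightarrow> 'v beauty_state \<Rightarrow> bool" where
  "beauty_inv l_est l_prune (Search \<sigma>) \<longleftrightarrow>
     (\<exists>\<kappa>. search_inv l_est l_prune (out_arcs_of (closed \<sigma>)) \<kappa> \<sigma>)"
| "beauty_inv l_est l_prune (Expand n S \<sigma>) \<longleftrightarrow>
     search_inv l_est l_prune (out_arcs_of (closed \<sigma>) - {n} \<times> S) (gl \<sigma> n) \<sigma> \<and>
     n \<in> closed \<sigma> \<and> {n} \<times> S \<subseteq> parcs (graph P)"
| "beauty_inv l_est l_prune (Returned (Some \<pi>) opt lo hi) \<longleftrightarrow>
     solution P \<pi> \<and> hi = ereal (tight_lower P \<pi>) \<and> lo \<in> ereal ` bound_values \<and> lo \<le> l_prune \<and>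
     (\<forall>p. solution P p \<longrightarrow> lo \<le> ereal (tight_lower P p)) \<and>
     opt = (hi \<le> lo) \<and> (\<not> opt \<longrightarrow> l_est < lo)"
| "beauty_inv l_est l_prune (Returned None opt lo hi) \<longleftrightarrow>
     (\<forall>p. solution P p \<longrightarrow> l_prune < ereal (tight_lower P p))"

lemma beauty_inv_returned:
  assumes inv: "search_inv l_est l_prune (out_arcs_of (closed \<sigma>)) \<kappa> \<sigma>"
    and min: "min_open \<sigma> n" and goal: "n \<in> goals P" and tr: "trace (parent \<sigma>) n \<pi>"
    and post: "post_search P \<sigma> \<pi> (gl \<sigma> n) = (opt, lo, hi)"
  shows "beauty_inv l_est l_prune (Returned (Some \<pi>) opt lo hi)"
proof -
  have "n \<in> opn \<sigma>" using min by (simp add: min_open_def)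
  then obtain p where p: "traced l_est l_prune \<sigma> n p" using search_inv_traced[OF inv] by blast
  then have "trace (parent \<sigma>) n p" by (simp add: traced_def)
  then have "p = \<pi>" using tr by (rule trace_unique)
  then have t: "traced l_est l_prune \<sigma> n \<pi>" using p by simp
  then have w: "awalk (source P) \<pi> n" and d: "distinct \<pi>" by (auto simp: traced_def)
  have arcs: "set \<pi> \<subseteq> parcs (graph P)" using w by (auto simp: awalk_def)
  have est: "estimated \<sigma> e" if "e \<in> set \<pi>" for e using t that by (simp add: traced_def)
  have full: "lb \<sigma> e = tight e" if "e \<in> set \<pi>" "applied \<sigma> e = length (ests P e)" for e
    using est[OF that(1)] that arcs tight_last[of e] ests_nonempty[of e]
    by (auto simp: estimated_def last_conv_nth)
  have val: "gl \<sigma> n = ereal (\<Sum>e\<leftarrow>\<pi>. lb \<sigma> e)" using t by (simp add: traced_def)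
  have "fst (fold (refine_edge P \<sigma>) \<pi> (gl \<sigma> n, lb \<sigma>)) =
      ereal ((\<Sum>e\<leftarrow>\<pi>. lb \<sigma> e) + (\<Sum>e\<leftarrow>\<pi>. tight e - lb \<sigma> e))"
    unfolding val
  proof (rule fold_refine_edge[OF d arcs])
    fix e assume e: "e \<in> set \<pi>"
    then have "applied \<sigma> e \<le> length (ests P e)" using est by (simp add: estimated_def)
    then show "applied \<sigma> e < length (ests P e) \<or> lb \<sigma> e = tight e"
      using full[OF e] by (auto simp: le_less)
  qed
  then have hi: "hi = ereal (tight_lower P \<pi>)" and lo: "lo = gl \<sigma> n" and opt: "opt = (hi \<le> lo)"
    using post by (auto simp: post_search_def Let_def tight_lower_sum sum_list_subtractf)
  have prune: "lo \<le> l_prune" using t unfolding lo traced_def by blast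
  \<comment> \<open>A key at most \<open>l_est\<close> would mean that all arcs of the path are
    exhausted; recorded and tightest bounds would agree, forcing \<open>opt\<close>.\<close>
  have "l_est < lo" if "\<not> opt"
  proof (rule ccontr)
    assume "\<not> l_est < lo"
    then have "\<forall>e \<in> set \<pi>. lb \<sigma> e = tight e" using t lo full by (auto simp: traced_def)
    then have "hi = lo"
      unfolding hi lo val tight_lower_sum
      by (intro arg_cong[where f = "\<lambda>xs. ereal (sum_list xs)"] map_cong) auto
    then show False using that opt by simp
  qed
  moreover have "lo \<le> ereal (tight_lower P p)" if p: "solution P p" for p
  \<comment> \<open>A solution within the pruning bound has an open key below it, and the popped key
    is minimal; any other exceeds \<open>l_prune\<close>, hence \<open>lo\<close>.\<close>
  proof (cases "ereal (tight_lower P p) \<le> l_prune")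
    case True
    then show ?thesis
      using open_below_solution[OF inv p] min lo by (auto simp: min_open_def intro: order_trans)
  next
    case False
    then show ?thesis using prune by simp
  qed
  moreover have "lb \<sigma> e \<in> lower ` set (ests P e)" if "e \<in> set \<pi>" for e
    using est[OF that] by (auto simp: estimated_def intro!: imageI nth_mem)
  then have "lo \<in> ereal ` bound_values"
    unfolding lo val using bound_valuesI[OF d arcs] by blast
  moreover have "solution P \<pi>" using w goal by (auto simp: solution_iff)
  ultimately show ?thesis using hi opt prune by simp
qed

text \<open>Popping a minimum lets \<kappa> rise to its key, and all arcs leaving \<open>n\<close>
  become pending.\<close>

lemma beauty_inv_expand:
  assumes inv: "search_inv l_est l_prune (out_arcs_of (closed \<sigma>)) \<kappa> \<sigma>"
    and min: "min_open \<sigma> n" and goal: "n \<notin> goals P"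
  shows "beauty_inv l_est l_prune (Expand n {s. (n, s) \<in> parcs (graph P)}
          (\<sigma>\<lparr>opn := opn \<sigma> - {n}, closed := insert n (closed \<sigma>)\<rparr>))"
proof -
  let ?\<tau> = "\<sigma>\<lparr>opn := opn \<sigma> - {n}, closed := insert n (closed \<sigma>)\<rparr>"
  have n: "n \<in> opn \<sigma>" and le: "\<And>m. m \<in> opn \<sigma> \<Longrightarrow> gl \<sigma> n \<le> gl \<sigma> m"
    using min by (auto simp: min_open_def)
  have nc: "n \<notin> closed \<sigma>" using inv n by (auto simp: search_inv_def)
  then have R: "out_arcs_of (insert n (closed \<sigma>)) - {n} \<times> {s. (n, s) \<in> parcs (graph P)}
      = out_arcs_of (closed \<sigma>)"
    by (auto simp: out_arcs_of_def)
  have "traced l_est l_prune ?\<tau> v p" if "traced l_est l_prune \<sigma> v p" for v p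
    using that by (auto simp: traced_def estimated_def)
  moreover have U: "opn ?\<tau> \<union> closed ?\<tau> = opn \<sigma> \<union> closed \<sigma>" using n by auto
  ultimately have tr: "\<forall>v \<in> opn ?\<tau> \<union> closed ?\<tau>. \<exists>p. traced l_est l_prune ?\<tau> v p"
    using search_inv_traced[OF inv] by metis
  have "gl \<sigma> v \<le> gl \<sigma> n" if "v \<in> insert n (closed \<sigma>)" for v
    using that inv n unfolding search_inv_def by (metis insert_iff order_refl order_trans)
  then have "search_inv l_est l_prune (out_arcs_of (closed \<sigma>)) (gl \<sigma> n) ?\<tau>"
    using inv tr le goal n unfolding search_inv_def U by auto
  then show ?thesis using R by auto
qed

lemma beauty_inv_step:
  assumes "beauty_step P l_est l_prune b b'" "beauty_inv l_est l_prune b"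
  shows "beauty_inv l_est l_prune b'"
  using assms
proof cases
  case (search_goal \<sigma> n \<pi> opt lo hi)
  then show ?thesis using assms(2) beauty_inv_returned by (metis beauty_inv.simps(1))
next
  case (search_expand \<sigma> n)
  then show ?thesis using assms(2) beauty_inv_expand by (metis beauty_inv.simps(1))
next
  \<comment> \<open>With an empty queue no open key lies below a solution, so all solutions exceed
    the pruning bound.\<close>
  case (search_fail \<sigma>)
  then show ?thesis using assms(2) open_below_solution
    by (force simp: not_le[symmetric])
next
  case (expand_succ s S n \<sigma>)
  let ?R = "out_arcs_of (closed \<sigma>) - {n} \<times> S"
  have inv: "search_inv l_est l_prune ?R (gl \<sigma> n) \<sigma>" and n: "n \<in> closed \<sigma>"
    and sub: "{n} \<times> S \<subseteq> parcs (graph P)"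
    using assms(2) expand_succ by auto
  have e: "(n, s) \<in> parcs (graph P)" "(n, s) \<notin> ?R" using sub expand_succ by auto
  have R: "insert (n, s) ?R = out_arcs_of (closed \<sigma>) - {n} \<times> (S - {s})"
    using e n expand_succ(3) by (auto simp: out_arcs_of_def)
  show ?thesis using search_inv_relax[OF inv n e] R n sub expand_succ by auto
next
  case (expand_done n \<sigma>)
  then show ?thesis using assms(2) by auto
qed

text \<open>A search could be stuck only for want of a minimal open vertex or of a trace; the former
  exists because the queue is finite, the latter by the invariant.\<close>

lemma beauty_step_exists:
  assumes "beauty_inv l_est l_prune b" "\<And>\<pi> opt lo hi. b \<noteq> Returned \<pi> opt lo hi"
  shows "\<exists>b'. beauty_step P l_est l_prune b b'"
proof (cases b)
  case (Search \<sigma>)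
  then obtain \<kappa> where inv: "search_inv l_est l_prune (out_arcs_of (closed \<sigma>)) \<kappa> \<sigma>" using assms by auto
  show ?thesis
  proof (cases "opn \<sigma> = {}")
    case True
    then show ?thesis using Search search_fail by blast
  next
    case False
    have "opn \<sigma> \<subseteq> pverts (graph P)" using inv by (auto simp: search_inv_def)
    then have fin: "finite (opn \<sigma>)" using pair_finite_verts by (rule finite_subset)
    define n where "n = arg_min_on (gl \<sigma>) (opn \<sigma>)"
    have n: "min_open \<sigma> n"
      using arg_min_if_finite(1)[OF fin False] arg_min_least[OF fin False]
      by (auto simp: min_open_def n_def)
    then have "n \<in> opn \<sigma>" by (simp add: min_open_def)
    then obtain p where p: "trace (parent \<sigma>) n p"
      using search_inv_traced[OF inv, of n] by (auto simp: traced_def)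
    obtain opt lo hi where "post_search P \<sigma> p (gl \<sigma> n) = (opt, lo, hi)" by (rule prod_cases3)
    then show ?thesis
      using search_goal[OF n _ p] search_expand[OF n] unfolding Search by blast
  qed
next
  case (Expand n S \<sigma>)
  show ?thesis
  proof (cases "S = {}")
    case True
    then show ?thesis unfolding Expand by (auto intro: expand_done)
  next
    case False
    then obtain s where "s \<in> S" by blast
    then show ?thesis unfolding Expand by (blast intro: expand_succ)
  qed
next
  case (Returned)
  then show ?thesis using assms by blast
qed

section \<open>Termination of BEAUTY\<close>

text \<open>Closing a vertex releases \<open>card (pverts (graph P)) + 3\<close>, enough to pay for
  its successors and the larger constant. The value \<open>2\<close> of a returned state leaves room
  for a last \<open>Loop\<close> and \<open>Halt\<close>.\<close>

fun beauty_measure :: "'v beauty_state \<Rightarrow> nat" where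
  "beauty_measure (Search \<sigma>) =
     card (pverts (graph P) - closed \<sigma>) * (card (pverts (graph P)) + 3) + 4"
| "beauty_measure (Expand n S \<sigma>) =
     card (pverts (graph P) - closed \<sigma>) * (card (pverts (graph P)) + 3) + card S + 5"
| "beauty_measure (Returned \<pi> opt lo hi) = 2"

lemma finite_succs: "finite {s. (n, s) \<in> parcs (graph P)}"
  and card_succs: "card {s. (n, s) \<in> parcs (graph P)} \<le> card (pverts (graph P))"
proof -
  have "{s. (n, s) \<in> parcs (graph P)} \<subseteq> pverts (graph P)" using in_arcsD2 by auto
  then show "finite {s. (n, s) \<in> parcs (graph P)}"
    "card {s. (n, s) \<in> parcs (graph P)} \<le> card (pverts (graph P))"
    by (auto intro: finite_subset card_mono)
qed

lemma beauty_measure_step: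
  assumes "beauty_step P l_est l_prune b b'" "beauty_inv l_est l_prune b"
  shows "beauty_measure b' < beauty_measure b"
  using assms(1)
proof cases
  case (search_expand \<sigma> n)
  have "n \<in> pverts (graph P) - closed \<sigma>"
    using assms(2) search_expand by (auto simp: search_inv_def min_open_def)
  then have "card (pverts (graph P) - closed \<sigma>) = Suc (card (pverts (graph P) - insert n (closed \<sigma>)))"
    by (metis Diff_insert card_Suc_Diff1 finite_Diff finite_verts with_proj_simps(1))
  then show ?thesis using search_expand card_succs[of n] by simp
next
  case (expand_succ s S n \<sigma>)
  have inv: "search_inv l_est l_prune (out_arcs_of (closed \<sigma>) - {n} \<times> S) (gl \<sigma> n) \<sigma>"
    and n: "n \<in> closed \<sigma>" and sub: "{n} \<times> S \<subseteq> parcs (graph P)"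
    using assms(2) expand_succ by auto
  then have "S \<subseteq> {s. (n, s) \<in> parcs (graph P)}" by auto
  \<comment> \<open>Needed because \<open>card\<close> would not drop on an infinite set.\<close>
  then have "finite S" using finite_succs finite_subset by blast
  then have "card (S - {s}) < card S" using expand_succ(3) by (rule card_Diff1_less)
  moreover have "closed (relax P l_est l_prune n s \<sigma>) = closed \<sigma>"
    using search_inv_relax[OF inv n] sub expand_succ by auto
  ultimately show ?thesis using expand_succ by simp
qed auto

section \<open>Correctness of A-BEAUTY\<close>

definition optimal_result :: "('v \<times> 'v) list option \<Rightarrow> ereal \<Rightarrow> bool" where
  "optimal_result r hi \<longleftrightarrow> (\<exists>\<pi>. r = Some \<pi> \<and> solution P \<pi> \<and> hi = ereal (tight_lower P \<pi>) \<and>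
     (\<forall>p. solution P p \<longrightarrow> tight_lower P \<pi> \<le> tight_lower P p))"

text \<open>The optimal path itself shows that the minimum behind \<open>LEAST\<close> is
  attained.\<close>

lemma optimal_result_L_star:
  assumes "optimal_result r hi"
  shows "\<exists>\<pi>. r = Some \<pi> \<and> solution P \<pi> \<and> tight_lower P \<pi> = L_star P \<and> hi = ereal (L_star P)"
proof -
  obtain \<pi> where \<pi>: "r = Some \<pi>" "solution P \<pi>" "hi = ereal (tight_lower P \<pi>)"
    "\<And>p. solution P p \<Longrightarrow> tight_lower P \<pi> \<le> tight_lower P p"
    using assms by (auto simp: optimal_result_def)
  then have "L_star P = tight_lower P \<pi>"
    unfolding L_star_def by (intro Least_equality) auto
  then show ?thesis using \<pi> by simp
qed

text \<open>Keeps pruning from excluding every solution, so that no call comes back without a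
  path.\<close>

definition attainable :: "ereal \<Rightarrow> bool" where
  "attainable hi \<longleftrightarrow> (\<exists>p. solution P p \<and> ereal (tight_lower P p) \<le> hi)"

text \<open>Supplies the premise of \<open>search_inv_init\<close>; tightest bounds are sums of
  nonnegative numbers.\<close>

lemma attainable_nonneg: "attainable hi \<Longrightarrow> 0 \<le> hi"
proof -
  assume "attainable hi"
  then obtain p v where p: "awalk (source P) p v" "ereal (tight_lower P p) \<le> hi"
    by (auto simp: attainable_def solution_iff)
  from p(1) have "set p \<subseteq> parcs (graph P)" by (auto simp: awalk_def)
  then have "0 \<le> ereal (tight_lower P p)" by (simp add: tight_lower_sum sum_tight_nonneg)
  then show ?thesis using p(2) by (rule order_trans)
qed

fun abeauty_inv :: "'v abeauty_state \<Rightarrow> bool" where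
  "abeauty_inv (Loop r opt lo hi) \<longleftrightarrow> attainable hi \<and> (opt \<longrightarrow> optimal_result r hi)"
| "abeauty_inv (Call lo hi b) \<longleftrightarrow> attainable hi \<and> beauty_inv lo hi b"
| "abeauty_inv (Halt r hi) \<longleftrightarrow> optimal_result r hi"

lemma abeauty_inv_step:
  assumes "abeauty_step P a a'" "abeauty_inv a"
  shows "abeauty_inv a'"
  using assms(1)
proof cases
  case (call_beauty \<pi> lo hi)
  then have "search_inv lo hi {} 0 (search_init P)"
    using assms(2) by (intro search_inv_init) (auto dest: attainable_nonneg)
  moreover have "out_arcs_of (closed (search_init P)) = {}"
    by (simp add: out_arcs_of_def search_init_def)
  ultimately show ?thesis using assms(2) call_beauty by auto
next
  case (run_beauty lo hi b b')
  then show ?thesis using assms(2) beauty_inv_step by auto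
next
  case (return_none lo hi opt lo' hi')
  \<comment> \<open>Contradictory: all solutions would exceed a bound that one of them
    respects.\<close>
  then show ?thesis using assms(2) by (auto simp: attainable_def not_le[symmetric])
next
  case (return_some lo hi \<pi> opt lo' hi')
  then have sol: "solution P \<pi>" and hi': "hi' = ereal (tight_lower P \<pi>)" and "lo' \<le> hi"
    and least: "\<And>p. solution P p \<Longrightarrow> lo' \<le> ereal (tight_lower P p)" and opt: "opt = (hi' \<le> lo')"
    and att: "attainable hi"
    using assms(2) by auto
  have "optimal_result (Some \<pi>) (if hi' < hi then hi' else hi)" if opt
  proof -
    \<comment> \<open>Together with \<open>lo' \<le> hi\<close> this makes \<open>hi'\<close> the
      new upper bound, while \<open>lo'\<close> lies below all solutions.\<close>
    have le: "hi' \<le> lo'" using that opt by simp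
    then have "(if hi' < hi then hi' else hi) = hi'" using \<open>lo' \<le> hi\<close> by auto
    moreover have "tight_lower P \<pi> \<le> tight_lower P p" if "solution P p" for p
      using order_trans[OF le least[OF that]] hi' by simp
    ultimately show ?thesis using sol hi' by (simp add: optimal_result_def)
  qed
  moreover have "attainable (if hi' < hi then hi' else hi)"
    using att sol hi' by (auto simp: attainable_def)
  ultimately show ?thesis using return_some by simp
next
  case (loop_done \<pi> lo hi)
  then show ?thesis using assms(2) by simp
qed

lemma abeauty_step_exists:
  assumes "abeauty_inv a" "\<And>r hi. a \<noteq> Halt r hi"
  shows "\<exists>a'. abeauty_step P a a'"
proof (cases a)
  case (Loop r opt lo hi)
  then show ?thesis by (cases opt) (auto intro: call_beauty loop_done)
next
  case (Call lo hi b)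
  show ?thesis
  proof (cases "\<exists>\<pi> opt lo' hi'. b = Returned \<pi> opt lo' hi'")
    case True
    then show ?thesis using Call return_none return_some by (metis not_Some_eq)
  next
    case False
    then show ?thesis using Call assms(1) beauty_step_exists[of lo hi b] run_beauty by (metis abeauty_inv.simps(2))
  qed
next
  case Halt
  then show ?thesis using assms by blast
qed

section \<open>Termination of A-BEAUTY\<close>

text \<open>Counts the lower bounds that a further call may return without setting
  \<open>opt\<close>.\<close>

definition values_above :: "ereal \<Rightarrow> nat" where
  "values_above lo = card {x \<in> bound_values. lo < ereal x}"

text \<open>The second component bounds the steps within a call. Once \<open>opt\<close> holds one
  step is left; \<open>(0, 1)\<close> lies below a returned state even if the first component was
  already \<open>0\<close>.\<close>

fun abeauty_measure :: "'v abeauty_state \<Rightarrow> nat \<times> nat" where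
  "abeauty_measure (Loop r opt lo hi) =
     (if opt then (0, 1) else (values_above lo, beauty_measure (Search (search_init P)) + 1))"
| "abeauty_measure (Call lo hi b) = (values_above lo, beauty_measure b)"
| "abeauty_measure (Halt r hi) = (0, 0)"

text \<open>The value \<open>lo'\<close> is counted for \<open>lo\<close> but not for
  itself.\<close>

lemma values_above_less:
  assumes "lo < lo'" "lo' \<in> ereal ` bound_values"
  shows "values_above lo' < values_above lo"
  unfolding values_above_def
proof (rule psubset_card_mono)
  show "finite {x \<in> bound_values. lo < ereal x}" using finite_bound_values by simp
  show "{x \<in> bound_values. lo' < ereal x} \<subset> {x \<in> bound_values. lo < ereal x}"
    using assms by (auto dest: less_trans)
qed

lemma abeauty_measure_step:
  assumes "abeauty_step P a a'" "abeauty_inv a"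
  shows "(abeauty_measure a', abeauty_measure a) \<in> less_than <*lex*> less_than"
  using assms(1)
proof cases
  case (run_beauty lo hi b b')
  then show ?thesis using assms(2) beauty_measure_step by auto
next
  case (return_some lo hi \<pi> opt lo' hi')
  then show ?thesis using assms(2) values_above_less[of lo lo'] by auto
qed auto

lemma abeauty_correct:
  assumes "\<exists>p. solution P p"
  shows "abeauty_halts P \<and> (\<forall>a. abeauty_final P a \<longrightarrow> (\<exists>r hi. a = Halt r hi \<and> optimal_result r hi))"
proof -
  have init: "abeauty_inv abeauty_init"
    using assms by (auto simp: abeauty_init_def attainable_def)
  have "abeauty_halts P"
    unfolding abeauty_halts_def
  proof
    assume "\<exists>r. r 0 = abeauty_init \<and> (\<forall>i::nat. abeauty_step P (r i) (r (Suc i)))"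
    then obtain r where r: "r 0 = abeauty_init" "\<And>i::nat. abeauty_step P (r i) (r (Suc i))" by blast
    have "abeauty_inv (r i)" for i
      by (induction i) (use r init abeauty_inv_step in auto)
    then have "(abeauty_measure (r (Suc i)), abeauty_measure (r i)) \<in> less_than <*lex*> less_than" for i
      using abeauty_measure_step r(2) by blast
    then show False
      using wf_no_infinite_down_chainE[of "less_than <*lex*> less_than" "\<lambda>i. abeauty_measure (r i)"]
      by blast
  qed
  moreover have "\<exists>r hi. a = Halt r hi \<and> optimal_result r hi" if "abeauty_final P a" for a
  proof -
    have "(abeauty_step P)\<^sup>*\<^sup>* abeauty_init a" using that by (simp add: abeauty_final_def)
    then have inv: "abeauty_inv a"
      by induction (use init abeauty_inv_step in auto)
    moreover have "\<nexists>a'. abeauty_step P a a'" using that by (simp add: abeauty_final_def)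
    \<comment> \<open>Progress excludes deadlocks, so a final state is a
      \<open>Halt\<close>.\<close>
    ultimately obtain r hi where "a = Halt r hi" using abeauty_step_exists by metis
    then show ?thesis using inv by simp
  qed
  ultimately show ?thesis by blast
qed

end

theorem theorem2:
  fixes P :: "'v slb"
  assumes "slb_instance P"
    and "\<exists>p. solution P p"
  shows "abeauty_halts P \<and>
    (\<forall>a. abeauty_final P a \<longrightarrow>
       (\<exists>\<pi> bound. a = Halt (Some \<pi>) bound \<and> solution P \<pi> \<and>
          tight_lower P \<pi> = L_star P \<and> bound = ereal (L_star P)))"
proof -
  interpret slb_problem P using assms(1) by unfold_locales
  show ?thesis using abeauty_correct[OF assms(2)] optimal_result_L_star by blast
qed

end
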